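(* Consider any differential privacy definition satisfying the following two axioms. (Axiom 1, hypothesis testing.) The definition is given through some "metric" $D$ between the probability distributions of the output of an algorithm applied to two neighboring datasets: $D$ assigns to every ordered pair $(P,Q)$ of probability distributions on the same space (the space may vary from pair to pair) an element $D(P,Q)$ of a parameter space $\Xi$ endowed with a partial order $\preceq$, and an algorithm $M$ is $\xi$-differentially private, for $\xi\in\Xi$, if $D(M(S),M(S'))\preceq\xi$ for all neighboring datasets $S,S'$. (Axiom 2, post-processing.) For every pair $(P,Q)$ of probability distributions on the same space and every post-processing operation (possibly randomized algorithm) $\mathrm{Proc}$ on that space, $D(\mathrm{Proc}(P),\mathrm{Proc}(Q))$ and $D(P,Q)$ are comparable and $$D(\mathrm{Proc}(P),\mathrm{Proc}(Q))\preceq D(P,Q).$$ Then $D$ must depend on the probability distributions through the trade-off function. That is, there must exist a link function $d$ defined on trade-off functions such that $$D(P,Q)=d\big(T(P,Q)\big)$$ for every pair $(P,Q)$ of probability distributions on the same space.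
   Context: Datasets and algorithms: two datasets $S,S'$ are neighboring if they differ in only one individual's record. $M(S)$ is identified with the probability distribution of the output of the (randomized) algorithm $M$ applied to $S$. An attacker tests $H_0$: $M$ is applied to $S$, against $H_1$: $M$ is applied to $S'$. The term "metric" is used in a broad sense: $D$ need not be univariate (real-valued), symmetric, or satisfy the triangle inequality. For $\xi_1,\xi_2\in\Xi$, $\xi_1\preceq\xi_2$ means that $\xi_1$ delivers a stronger privacy guarantee than $\xi_2$. Post-processing: for a (possibly randomized) algorithm $\mathrm{Proc}$ taking points of one space as input and producing output in a possibly different space, $\mathrm{Proc}(P)$ denotes the probability distribution of the output when the input is drawn from $P$. Trade-off function: for probability distributions $P,Q$ on the same space, $T(P,Q):[0,1]\to[0,1]$ is $$T(P,Q)(\alpha)=\inf_{\phi}\{\,1-\mathbb{E}_Q\phi \;:\; \mathbb{E}_P\phi\le\alpha\,\},$$ where the infimum is over all rejection rules $\phi$ with $0\le\phi\le1$. This is the smallest type II error for testing $H_0:P$ against $H_1:Q$ among tests with type I error at most $\alpha$. A trade-off function is any function of the form $T(P,Q)$.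
   Formalization: The spaces carrying P, Q and the outputs of Proc are taken to be standard Borel (subsets of one arbitrary universe) and Proc is a Markov kernel; on arbitrary measurable spaces the claim fails, since equal trade-off functions need not give mutual post-processing. *)

theory Defs
  imports "HOL-Probability.Probability"
begin

text \<open>
  Spaces are \<^typ>\<open>'a measure\<close> values used only through their carrier and sigma-algebra. The type
  \<^typ>\<open>'a\<close> is an arbitrary universe of outcomes, and a space may have any subset of it as its
  carrier, so different pairs of distributions may live on different spaces.

  Spaces are standard Borel and randomized algorithms are Markov kernels. On arbitrary measurable
  spaces the link-function theorem fails for Markov kernels: a statistic can be sufficient without
  the original pair of distributions being recoverable from it by a kernel.
\<close>

definition standard_borel :: "'a measure \<Rightarrow> bool" where
  "standard_borel N \<longleftrightarrow>
     (\<exists>X. completely_metrizable_space X \<and> second_countable X \<and>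
          space N = topspace X \<and> sets N = sigma_sets (topspace X) {U. openin X U})"

definition distributions_on_same_space :: "'a measure \<Rightarrow> 'a measure \<Rightarrow> bool" where
  "distributions_on_same_space P Q \<longleftrightarrow>
     (\<exists>N. standard_borel N \<and> P \<in> space (prob_algebra N) \<and> Q \<in> space (prob_algebra N))"

definition rejection_rule :: "'a measure \<Rightarrow> ('a \<Rightarrow> real) \<Rightarrow> bool" where
  "rejection_rule N \<phi> \<longleftrightarrow> \<phi> \<in> borel_measurable N \<and> (\<forall>x\<in>space N. 0 \<le> \<phi> x \<and> \<phi> x \<le> 1)"

definition trade_off :: "'a measure \<Rightarrow> 'a measure \<Rightarrow> real \<Rightarrow> real" where
  "trade_off P Q =
     (\<lambda>\<alpha>\<in>{0..1}. INF \<phi>\<in>{\<phi>. rejection_rule P \<phi> \<and> integral\<^sup>L P \<phi> \<le> \<alpha>}. 1 - integral\<^sup>L Q \<phi>)"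

definition neighboring :: "'r list \<Rightarrow> 'r list \<Rightarrow> bool" where
  "neighboring S S' \<longleftrightarrow> length S = length S' \<and> (\<exists>!i. i < length S \<and> S ! i \<noteq> S' ! i)"

text \<open>A randomized algorithm on datasets is identified with its family of output distributions.\<close>

definition randomized_algorithm :: "('r list \<Rightarrow> 'a measure) \<Rightarrow> bool" where
  "randomized_algorithm M \<longleftrightarrow>
     (\<exists>N. standard_borel N \<and> (\<forall>S. M S \<in> space (prob_algebra N)))"

text \<open>
  In the two axioms \<^term>\<open>dp \<xi> M\<close> reads: the algorithm \<^term>\<open>M\<close> is \<^term>\<open>\<xi>\<close>-differentially
  private. The order \<open>\<le>\<close> of the parameter type is the partial order on privacy parameters, smaller
  meaning more private.
\<close>

definition hypothesis_testing_axiom ::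
    "('xi::order \<Rightarrow> ('r list \<Rightarrow> 'a measure) \<Rightarrow> bool) \<Rightarrow> ('a measure \<Rightarrow> 'a measure \<Rightarrow> 'xi) \<Rightarrow> bool" where
  "hypothesis_testing_axiom dp D \<longleftrightarrow>
     (\<forall>\<xi> M. randomized_algorithm M \<longrightarrow>
        (dp \<xi> M \<longleftrightarrow> (\<forall>S S'. neighboring S S' \<longrightarrow> D (M S) (M S') \<le> \<xi>)))"

definition post_processing_axiom ::
    "('a measure \<Rightarrow> 'a measure \<Rightarrow> 'xi::order) \<Rightarrow> bool" where
  "post_processing_axiom D \<longleftrightarrow>
     (\<forall>P Q L Proc. distributions_on_same_space P Q \<longrightarrow> standard_borel L \<longrightarrow>
        Proc \<in> P \<rightarrow>\<^sub>M prob_algebra L \<longrightarrow>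
        D (P \<bind> Proc) (Q \<bind> Proc) \<le> D P Q)"

end

theory Submission
  imports Defs
begin

text \<open>
  Put \<open>M = P + Q\<close> and \<open>T = dQ/dM\<close>, so that \<open>dP/dM = 1 - T\<close>. For \<open>0 \<le> r \<le> 1\<close> the best value of
  \<open>(1 - r) E\<^sub>Q \<phi> - r E\<^sub>P \<phi>\<close> over rejection rules is the integral of \<open>max 0 (T - r)\<close> against \<open>M\<close>; the
  trade-off function determines this number, and its slopes in \<open>r\<close> give \<open>M {T > r}\<close>. Hence the trade-off
  function determines the law of \<open>T\<close>. Conversely \<open>T\<close> is sufficient: a regular conditional distribution given
  \<open>T\<close>, which exists on a standard Borel space, is a kernel that recovers both \<open>P\<close> and \<open>Q\<close> from their images
  under \<open>T\<close>. So two pairs with the same trade-off function are post-processings of each other (apply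
  the likelihood ratio of one pair, then the kernel of the other), and antisymmetry of the order makes
  the values of \<open>D\<close> agree.

  Only a measurable retraction from the real line onto the space is needed for the conditional
  distribution, not a Borel isomorphism, and the composed kernel never leaves the outcome type, which
  may be too small to contain the interval.
\<close>

subsection \<open>Standard Borel spaces as retracts of the real line\<close>

text \<open>Base 3 with digits 0 and 1 only: the tail behind any digit stays below one half, so \<open>floor\<close> recovers
  the digits without the usual ambiguity of binary expansions.\<close>

definition ternary_encode :: "(nat \<Rightarrow> bool) \<Rightarrow> real" where
  "ternary_encode b = (\<Sum>n. of_bool (b n) * (1/3) ^ Suc n)"

definition ternary_decode :: "real \<Rightarrow> nat \<Rightarrow> bool" where
  "ternary_decode c n \<longleftrightarrow> \<lfloor>3 ^ Suc n * c\<rfloor> mod 3 = 1"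

lemma summable_ternary: "summable (\<lambda>n. of_bool (b n) * (1/3::real) ^ Suc n)"
proof (rule summable_comparison_test')
  show "summable (\<lambda>n. (1/3::real) ^ Suc n)"
    by (simp add: summable_geometric)
qed auto

text \<open>Multiplying by 3 exposes the first digit and shifts the others; the induction in
  \<open>ternary_decode_encode\<close> recurses on this.\<close>

lemma ternary_encode_rec:
  "ternary_encode b = (of_bool (b 0) + ternary_encode (\<lambda>n. b (Suc n))) / 3"
proof -
  have "(\<Sum>n. of_bool (b (Suc n)) * (1/3::real) ^ Suc (Suc n))
      = (\<Sum>n. (of_bool (b (Suc n)) * (1/3) ^ Suc n) * (1/3))"
    by (rule arg_cong[where f = suminf]) (auto simp: fun_eq_iff)
  also have "\<dots> = ternary_encode (\<lambda>n. b (Suc n)) * (1/3)"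
    unfolding ternary_encode_def by (intro suminf_mult2[symmetric] summable_ternary)
  finally show ?thesis
    using suminf_split_head[OF summable_ternary[of b]]
    by (simp add: ternary_encode_def field_simps)
qed

lemma ternary_encode_bounds: "0 \<le> ternary_encode b" "ternary_encode b \<le> 1/2"
proof -
  show "0 \<le> ternary_encode b"
    unfolding ternary_encode_def by (intro suminf_nonneg summable_ternary) auto
  have s: "(\<lambda>n. (1/3::real) ^ Suc n) sums (1/3 * (1 / (1 - 1/3)))"
    using sums_mult[OF geometric_sums[of "1/3::real"], of "1/3"] by simp
  have "ternary_encode b \<le> (\<Sum>n. (1/3::real) ^ Suc n)"
    unfolding ternary_encode_def
    by (intro suminf_le summable_ternary sums_summable[OF s]) auto
  then show "ternary_encode b \<le> 1/2"
    using sums_unique[OF s] by simp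
qed

text \<open>After scaling, the leading digit contributes a multiple of 3, which \<open>mod 3\<close>
  discards, so a later digit of \<open>b\<close> is an earlier digit of the shifted sequence; hence
  \<open>b\<close> stays arbitrary in the induction.\<close>

lemma ternary_decode_encode: "ternary_decode (ternary_encode b) n \<longleftrightarrow> b n"
proof (induction n arbitrary: b)
  case 0
  have "\<lfloor>3 * ternary_encode b\<rfloor> = of_bool (b 0)"
    using ternary_encode_bounds[of "\<lambda>n. b (Suc n)"] ternary_encode_rec[of b]
    by (auto simp: floor_eq_iff)
  then show ?case
    by (auto simp: ternary_decode_def)
next
  case (Suc n)
  have "3 ^ Suc (Suc n) * ternary_encode b
      = of_int (3 * (3 ^ n * of_bool (b 0))) + 3 ^ Suc n * ternary_encode (\<lambda>n. b (Suc n))"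
    by (subst ternary_encode_rec) (auto simp: field_simps)
  then have "\<lfloor>3 ^ Suc (Suc n) * ternary_encode b\<rfloor>
      = 3 * (3 ^ n * of_bool (b 0)) + \<lfloor>3 ^ Suc n * ternary_encode (\<lambda>n. b (Suc n))\<rfloor>"
    by (metis floor_add_int add.commute)
  then have "ternary_decode (ternary_encode b) (Suc n)
      \<longleftrightarrow> ternary_decode (ternary_encode (\<lambda>n. b (Suc n))) n"
    by (simp only: ternary_decode_def mod_mult_self4)
  then show ?case
    by (simp add: Suc)
qed

lemma measurable_ternary_encode:
  assumes [measurable]: "\<And>n. Measurable.pred M (\<lambda>x. b x n)"
  shows "(\<lambda>x. ternary_encode (b x)) \<in> borel_measurable M"
  unfolding ternary_encode_def by measurable

lemma measurable_ternary_decode [measurable]: "Measurable.pred borel (\<lambda>c. ternary_decode c n)"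
  unfolding ternary_decode_def by measurable

text \<open>Long steps are refused, so the walk is Cauchy whatever the input sequence is; this makes the decoding
  map below total without a case distinction on convergence.\<close>

fun damped_walk :: "('b \<Rightarrow> 'b \<Rightarrow> real) \<Rightarrow> (nat \<Rightarrow> 'b) \<Rightarrow> nat \<Rightarrow> 'b" where
  "damped_walk d s 0 = s 0"
| "damped_walk d s (Suc m) =
     (if d (damped_walk d s m) (s (Suc m)) < 2 * (1/2) ^ m then s (Suc m) else damped_walk d s m)"

lemma (in Metric_space) damped_walk_in:
  assumes "\<And>m. s m \<in> M"
  shows "damped_walk d s m \<in> M"
  using assms by (induction m) auto

text \<open>Accepted steps are shorter than \<open>2 * (1/2) ^ n\<close>, refused ones have length
  0, and the bounds add up geometrically. Keeping the exact remainder \<open>- 4 * (1/2) ^ n\<close>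
  lets the induction close.\<close>

lemma (in Metric_space) damped_walk_dist:
  assumes s: "\<And>m. s m \<in> M"
  shows "m \<le> n \<Longrightarrow> d (damped_walk d s m) (damped_walk d s n) \<le> 4 * (1/2) ^ m - 4 * (1/2) ^ n"
proof (induction n rule: nat_induct_at_least)
  case base
  then show ?case using damped_walk_in[OF s] by simp
next
  case (Suc n)
  have step: "d (damped_walk d s n) (damped_walk d s (Suc n)) \<le> 2 * (1/2) ^ n"
    using damped_walk_in[of s n, OF s] by auto
  have "d (damped_walk d s m) (damped_walk d s (Suc n))
      \<le> d (damped_walk d s m) (damped_walk d s n) + d (damped_walk d s n) (damped_walk d s (Suc n))"
    by (intro triangle damped_walk_in s)
  then show ?case
    using Suc.IH step unfolding power_Suc by linarith
qed

text \<open>Completeness supplies the limit. The rate is the same for all input sequences, so each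
  position of the walk locates the limit with a known error.\<close>

lemma (in Metric_space) damped_walk_limit:
  assumes s: "\<And>m. s m \<in> M" and "mcomplete"
  shows "\<exists>l\<in>M. \<forall>m. d (damped_walk d s m) l \<le> 4 * (1/2) ^ m"
proof -
  let ?y = "damped_walk d s"
  have y: "?y m \<in> M" for m by (rule damped_walk_in[OF s])
  have le: "d (?y m) (?y n) \<le> 4 * (1/2) ^ m" if "m \<le> n" for m n
  proof -
    have "(0::real) \<le> 4 * (1/2) ^ n" by simp
    with damped_walk_dist[of s m n, OF s that] show ?thesis by linarith
  qed
  have "MCauchy ?y"
    unfolding MCauchy_def
  proof (intro conjI allI impI)
    fix e :: real assume "e > 0"
    then obtain N where N: "(1/2) ^ N < e / 4"
      using real_arch_pow_inv[of "e/4" "1/2"] by auto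
    show "\<exists>N. \<forall>n n'. N \<le> n \<longrightarrow> N \<le> n' \<longrightarrow> d (?y n) (?y n') < e"
    proof (intro exI allI impI)
      fix n n' assume nn: "N \<le> n" "N \<le> n'"
      have *: "d (?y a) (?y b) < e" if "N \<le> a" "a \<le> b" for a b
      proof -
        have "(1/2::real) ^ a \<le> (1/2) ^ N" using that by (intro power_decreasing) auto
        then show ?thesis using le[OF that(2)] N by linarith
      qed
      show "d (?y n) (?y n') < e"
        using *[of n n'] *[of n' n] nn by (metis commute nle_le)
    qed
  qed (use y in auto)
  with \<open>mcomplete\<close> obtain l where l: "limitin mtopology ?y l sequentially"
    unfolding mcomplete_def by auto
  then have lM: "l \<in> M" by (rule limitin_mspace)
  have "d (?y m) l \<le> 4 * (1/2) ^ m" for m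
  proof (rule field_le_epsilon)
    fix e :: real assume "e > 0"
    then obtain N where N: "\<And>n. n \<ge> N \<Longrightarrow> d (?y n) l < e"
      using l unfolding limit_metric_sequentially by blast
    have "d (?y m) l \<le> d (?y m) (?y (max m N)) + d (?y (max m N)) l"
      by (intro triangle y lM)
    then show "d (?y m) l \<le> 4 * (1/2) ^ m + e"
      using le[of m "max m N"] N[of "max m N"] by simp
  qed
  with lM show ?thesis by blast
qed

section \<open>Coding the points of a Polish space by real numbers\<close>

lemma separable_space_if_second_countable:
  assumes "second_countable X"
  shows "separable_space X"
proof -
  obtain B where B: "countable B" "\<And>V. V \<in> B \<Longrightarrow> openin X V"
    "\<And>U x. openin X U \<and> x \<in> U \<longrightarrow> (\<exists>V\<in>B. x \<in> V \<and> V \<subseteq> U)"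
    using assms by (auto simp: second_countable_def)
  define C where "C = (\<lambda>V. SOME x. x \<in> V) ` (B - {{}})"
  have some: "(SOME x. x \<in> V) \<in> V" if "V \<in> B - {{}}" for V
    using that by (auto simp: some_in_eq)
  show ?thesis
    unfolding separable_space_def
  proof (intro exI conjI)
    show "countable C" using B(1) by (auto simp: C_def)
    show "C \<subseteq> topspace X"
      using some B(2) openin_subset unfolding C_def by blast
    have "x \<in> X closure_of C" if "x \<in> topspace X" for x
      unfolding in_closure_of
    proof (intro conjI allI impI that)
      fix T assume T: "x \<in> T \<and> openin X T"
      then obtain V where "V \<in> B" "x \<in> V" "V \<subseteq> T" using B(3)[of T x] by blast
      then show "\<exists>y. y \<in> C \<and> y \<in> T"
        using some[of V] by (auto simp: C_def)
    qed
    then show "X closure_of C = topspace X"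
      using closure_of_subset_topspace by fast
  qed
qed

text \<open>One real number records which balls of radius \<open>(1/2) ^ m\<close> around the points
  of a dense sequence contain a given point. The decoder \<open>g\<close> reads off one centre for
  each \<open>m\<close> and takes the limit of their damped walk; it is total, but inverts
  \<open>i\<close> only on codes of points.\<close>

lemma standard_borel_retract_real:
  assumes "standard_borel N" and "space N \<noteq> {}"
  obtains i :: "'a \<Rightarrow> real" and g
  where "i \<in> borel_measurable N" "\<And>x. 0 \<le> i x \<and> i x \<le> 1"
    "g \<in> borel \<rightarrow>\<^sub>M N" "\<And>x. x \<in> space N \<Longrightarrow> g (i x) = x"
proof -
  obtain X where X: "completely_metrizable_space X" "second_countable X"
    "space N = topspace X" "sets N = sigma_sets (topspace X) {U. openin X U}"
    using assms(1) unfolding standard_borel_def by blast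
  obtain M d where "Metric_space M d" and compl: "Metric_space.mcomplete M d"
    and Xeq: "X = Metric_space.mtopology M d"
    using X(1) unfolding completely_metrizable_space_def by blast
  interpret Metric_space M d by fact
  have spN: "space N = M" by (simp add: X Xeq)
  have setsN: "sets N = sigma_sets M {U. openin mtopology U}" by (simp add: X Xeq)
  have openN: "U \<in> sets N" if "openin mtopology U" for U
    using that by (auto simp: setsN)
  obtain C where C: "countable C" "C \<subseteq> M" "mtopology closure_of C = M"
    using separable_space_if_second_countable[OF X(2)] by (auto simp: separable_space_def Xeq)
  have "C \<noteq> {}" using C(3) assms(2) by (auto simp: spN)
  define x where "x = from_nat_into C"
  have xM: "x k \<in> M" for k
    using from_nat_into[OF \<open>C \<noteq> {}\<close>, of k] C(2) by (auto simp: x_def)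
  have dense: "\<exists>k. d z (x k) < e" if z: "z \<in> M" and "e > 0" for z e
  proof -
    have "z \<in> mtopology closure_of C" using C(3) z by simp
    then obtain y where "y \<in> C" "y \<in> mball z e"
      using \<open>e > 0\<close> unfolding metric_closure_of by blast
    moreover then obtain k where "y = x k"
      using from_nat_into_surj[OF C(1)] unfolding x_def by metis
    ultimately show ?thesis by (auto simp: in_mball)
  qed
  \<comment> \<open>The first centre that the code \<open>e\<close> claims to be within
    \<open>(1/2) ^ m\<close> of the point. A real that codes no point may claim none;
    \<open>LEAST\<close> then yields an unspecified index, which the damped walk tolerates.\<close>
  define s where "s e m = (LEAST k. e (prod_encode (k, m)))" for e m
  \<comment> \<open>The walk runs on indices instead of points, so its positions are discrete-valued
    functions of \<open>c\<close> and their measurability follows by induction.\<close>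
  define w where "w c = damped_walk (\<lambda>k l. d (x k) (x l)) (s (ternary_decode c))" for c
  have xw: "x (w c m) = damped_walk d (\<lambda>m. x (s (ternary_decode c) m)) m" for c m
    unfolding w_def by (induction m) auto
  define g where
    "g c = (SOME l. l \<in> M \<and> (\<forall>m. d (x (w c m)) l \<le> 4 * (1/2) ^ m))" for c
  have g: "g c \<in> M \<and> (\<forall>m. d (x (w c m)) (g c) \<le> 4 * (1/2) ^ m)" for c
    unfolding g_def
    by (rule someI_ex)
      (use damped_walk_limit[OF _ compl, of "\<lambda>m. x (s (ternary_decode c) m)"] xM in \<open>auto simp: xw\<close>)
  define i where
    "i z = ternary_encode (\<lambda>n. case prod_decode n of (k, m) \<Rightarrow> z \<in> mball (x k) ((1/2) ^ m))" for z

  have "i \<in> borel_measurable N"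
    unfolding i_def
  proof (rule measurable_ternary_encode)
    fix n
    show "Measurable.pred N (\<lambda>z. case prod_decode n of (k, m) \<Rightarrow> z \<in> mball (x k) ((1/2) ^ m))"
    proof (cases "prod_decode n")
      case (Pair k m)
      have "{z \<in> space N. z \<in> mball (x k) ((1/2) ^ m)} = mball (x k) ((1/2) ^ m)"
        by (auto simp: spN)
      then show ?thesis
        using openN[OF openin_mball[of "x k" "(1/2) ^ m"]] by (simp only: Pair case_prod_conv pred_def)
    qed
  qed
  moreover have "0 \<le> i z \<and> i z \<le> 1" for z
    using ternary_encode_bounds[of "\<lambda>n. case prod_decode n of (k, m) \<Rightarrow> z \<in> mball (x k) ((1/2) ^ m)"]
    by (simp add: i_def)
  moreover have "g \<in> borel \<rightarrow>\<^sub>M N"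
  proof -
    have s_meas [measurable]: "(\<lambda>c. s (ternary_decode c) m) \<in> measurable borel (count_space UNIV)" for m
      unfolding s_def by measurable
    have w_meas [measurable]: "(\<lambda>c. w c m) \<in> measurable borel (count_space UNIV)" for m
    proof (induction m)
      case 0 then show ?case by (simp add: w_def)
    next
      case (Suc m)
      have "(\<lambda>c. w c (Suc m)) = (\<lambda>c. if d (x (w c m)) (x (s (ternary_decode c) (Suc m))) < 2 * (1/2) ^ m
        then s (ternary_decode c) (Suc m) else w c m)"
        by (simp only: w_def damped_walk.simps)
      moreover note Suc[measurable]
      ultimately show ?case by simp
    qed
    show ?thesis
    proof (rule measurable_sigma_sets[OF setsN])
      show "{U. openin mtopology U} \<subseteq> Pow M" using openin_subset by fastforce
      show "g \<in> space borel \<rightarrow> M" using g by auto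
      fix U assume "U \<in> {U. openin mtopology U}"
      then have U: "openin mtopology U" by simp
      \<comment> \<open>The radius is the error bound of the walk at position \<open>m\<close>, so a
        position in \<open>V m\<close> traps the limit in \<open>U\<close>.\<close>
      define V where "V m = {k. mcball (x k) (4 * (1/2) ^ m) \<subseteq> U}" for m
      \<comment> \<open>Membership of the limit in \<open>U\<close> is witnessed by some index of the walk, which is discrete-valued.\<close>
      have "g c \<in> U \<longleftrightarrow> (\<exists>m. w c m \<in> V m)" for c
      proof
        assume "g c \<in> U"
        then obtain r where r: "r > 0" "mball (g c) r \<subseteq> U"
          using U unfolding openin_mtopology by blast
        \<comment> \<open>Two distances of at most \<open>4 * (1/2) ^ m\<close> have to add up to
          less than \<open>r\<close>.\<close>
        then obtain m where m: "(1/2) ^ m < r / 8"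
          using real_arch_pow_inv[of "r/8" "1/2"] by auto
        have "mcball (x (w c m)) (4 * (1/2) ^ m) \<subseteq> mball (g c) r"
        proof
          fix y assume "y \<in> mcball (x (w c m)) (4 * (1/2) ^ m)"
          then have y: "y \<in> M" "d (x (w c m)) y \<le> 4 * (1/2) ^ m" by auto
          have "d (g c) y \<le> d (g c) (x (w c m)) + d (x (w c m)) y"
            using g xM y by (intro triangle) auto
          then have "d (g c) y < r"
            using conjunct2[OF g[of c], THEN spec, of m] y m commute[of "g c" "x (w c m)"] by linarith
          then show "y \<in> mball (g c) r" using g y by auto
        qed
        with r show "\<exists>m. w c m \<in> V m" unfolding V_def by blast
      next
        assume "\<exists>m. w c m \<in> V m"
        then show "g c \<in> U" using g[of c] xM unfolding V_def by auto
      qed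
      then have "g -` U \<inter> space borel = {c \<in> space borel. \<exists>m. w c m \<in> V m}" by auto
      also have "\<dots> \<in> sets borel" by measurable
      finally show "g -` U \<inter> space borel \<in> sets borel" .
    qed
  qed
  moreover have "g (i z) = z" if "z \<in> space N" for z
  proof -
    have z: "z \<in> M" using that spN by simp
    have sz: "d (x (s (ternary_decode (i z)) m)) z < (1/2) ^ m" for m
    proof -
      have "\<exists>k. d z (x k) < (1/2) ^ m" by (intro dense z) auto
      then have "\<exists>k. ternary_decode (i z) (prod_encode (k, m))"
        using xM z by (auto simp: i_def ternary_decode_encode commute)
      then have "ternary_decode (i z) (prod_encode (s (ternary_decode (i z)) m, m))"
        unfolding s_def by (rule LeastI_ex)
      then show ?thesis
        by (auto simp: i_def ternary_decode_encode)
    qed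
    \<comment> \<open>On the code of a point no step is refused: consecutive centres are both close
      to \<open>z\<close>, so the triangle inequality keeps them within the permitted step
      length.\<close>
    have wz: "w (i z) m = s (ternary_decode (i z)) m" for m
    proof (induction m)
      case 0 then show ?case by (simp add: w_def)
    next
      case (Suc m)
      let ?s = "s (ternary_decode (i z))"
      have "d (x (?s m)) (x (?s (Suc m))) \<le> d (x (?s m)) z + d z (x (?s (Suc m)))"
        by (intro triangle xM z)
      also have "\<dots> < (1/2) ^ m + (1/2) ^ Suc m"
        using sz[of m] sz[of "Suc m"] by (simp add: commute)
      also have "\<dots> \<le> 2 * (1/2) ^ m" by simp
      finally show ?case using Suc by (simp add: w_def)
    qed
    have gi: "g (i z) \<in> M" "\<And>m. d (x (w (i z) m)) (g (i z)) \<le> 4 * (1/2) ^ m"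
      using g by auto
    have "d (g (i z)) z \<le> 0"
    proof (rule field_le_epsilon)
      fix e :: real assume "e > 0"
      then obtain m where m: "(1/2) ^ m < e / 5"
        using real_arch_pow_inv[of "e/5" "1/2"] by auto
      have "d (g (i z)) z \<le> d (g (i z)) (x (w (i z) m)) + d (x (w (i z) m)) z"
        by (intro triangle gi xM z)
      then show "d (g (i z)) z \<le> 0 + e"
        using gi(2)[of m] sz[of m] m by (simp add: wz commute)
    qed
    then show ?thesis using gi(1) z using nonneg[of "g (i z)" z] zero[of "g (i z)" z] by simp
  qed
  ultimately show thesis using that by blast
qed

subsection \<open>Regular conditional distributions\<close>

text \<open>The infimum over strictly larger rationals makes \<open>F\<close> right-continuous
  whatever \<open>h\<close> does, at the price that \<open>F\<close> may differ from
  \<open>h\<close> at rational points. The boundary values of \<open>h\<close> fix the limits 0 and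
  1.\<close>

lemma cdf_of_rational_cdf:
  fixes h :: "rat \<Rightarrow> real"
  assumes mono: "\<And>r s. r \<le> s \<Longrightarrow> h r \<le> h s"
    and one: "\<And>r. 1 \<le> r \<Longrightarrow> h r = 1" and zero: "\<And>r. r < 0 \<Longrightarrow> h r = 0"
  defines "F \<equiv> \<lambda>x. INF r\<in>{r. x < of_rat r}. h r"
  shows "real_distribution (interval_measure F)" "emeasure (interval_measure F) {..x} = ennreal (F x)"
proof -
  have h0: "0 \<le> h r" for r
    using mono[of "min r (- 1)" r] zero[of "min r (- 1)"] by simp
  have ne: "{r. x < of_rat r} \<noteq> {}" for x :: real
    using of_rat_dense[of x "x + 1"] by auto
  have bdd: "bdd_below (h ` A)" for A
    by (rule bdd_belowI2[where m = 0]) (rule h0)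
  have F_le: "F x \<le> h r" if "x < of_rat r" for x r
    unfolding F_def using that by (intro cINF_lower bdd) simp
  have F_greater: "\<exists>r. x < of_rat r \<and> h r < c" if "F x < c" for x c
    using that ne[of x] bdd by (auto simp: F_def cINF_less_iff)
  have F0: "0 \<le> F x" for x
    unfolding F_def by (intro cINF_greatest ne h0)
  have F_mono: "F x \<le> F y" if "x \<le> y" for x y
    unfolding F_def by (rule cINF_superset_mono[OF ne bdd]) (use that in auto)
  have F_right: "continuous (at_right a) F" for a
    unfolding continuous_within
  proof (rule order_tendstoI)
    fix c assume c: "c < F a"
    show "\<forall>\<^sub>F y in at_right a. c < F y"
      unfolding eventually_at_right_field
      by (rule exI[of _ "a + 1"]) (use less_le_trans[OF c F_mono] in auto)
  next
    fix c assume "F a < c"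
    then obtain r where r: "a < of_rat r" "h r < c" using F_greater by blast
    show "\<forall>\<^sub>F y in at_right a. F y < c"
      unfolding eventually_at_right_field
      by (rule exI[of _ "of_rat r"]) (use r le_less_trans[OF F_le r(2)] in auto)
  qed
  have F_neg: "F x = 0" if "x < 0" for x
  proof -
    obtain r where "x < of_rat r" "of_rat r < (0::real)" using of_rat_dense[OF \<open>x < 0\<close>] by blast
    then show ?thesis using F_le[of x r] zero[of r] F0[of x] by simp
  qed
  have F_one: "F x = 1" if "1 \<le> x" for x
  proof -
    have "h r = 1" if "x < of_rat r" for r
    proof (rule one)
      have "of_rat 1 \<le> (of_rat r :: real)" using that \<open>1 \<le> x\<close> by (simp del: one_le_of_rat_iff)
      then show "1 \<le> r" unfolding of_rat_less_eq .
    qed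
    then have "F x = (INF r\<in>{r. x < of_rat r}. 1)"
      unfolding F_def by (intro INF_cong) auto
    then show ?thesis using ne by simp
  qed
  have bot: "(F \<longlongrightarrow> 0) at_bot"
    by (rule tendsto_eventually) (auto simp: eventually_at_bot_linorder F_neg intro!: exI[of _ "-1"])
  have top: "(F \<longlongrightarrow> 1) at_top"
    by (rule tendsto_eventually) (auto simp: eventually_at_top_linorder F_one intro!: exI[of _ "1"])
  show "real_distribution (interval_measure F)"
    by (rule real_distribution_interval_measure[OF F_mono F_right bot top])
  show "emeasure (interval_measure F) {..x} = ennreal (F x)"
    by (rule emeasure_interval_measure_Iic[OF F_mono F_right bot])
qed

text \<open>Test the hypothesis on the set where \<open>g < f\<close>: were it not null, the
  integral of \<open>f\<close> over it would exceed that of \<open>g\<close>, strictly because the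
  latter is finite.\<close>

lemma (in sigma_finite_measure) AE_mono_of_density_le:
  assumes [measurable]: "f \<in> borel_measurable M" "g \<in> borel_measurable M"
    and fin: "emeasure (density M g) (space M) < \<infinity>"
    and le: "\<And>A. A \<in> sets M \<Longrightarrow> emeasure (density M f) A \<le> emeasure (density M g) A"
  shows "AE x in M. f x \<le> g x"
proof -
  define A where "A = {x \<in> space M. g x < f x}"
  have [measurable]: "A \<in> sets M" unfolding A_def by measurable
  have "AE x in M. f x * indicator A x \<le> g x * indicator A x"
  proof (rule ccontr)
    assume *: "\<not> ?thesis"
    have "(\<integral>\<^sup>+x. g x * indicator A x \<partial>M) < (\<integral>\<^sup>+x. f x * indicator A x \<partial>M)"
    proof (rule nn_integral_less[OF _ _ _ _ *])
      have "(\<integral>\<^sup>+x. g x * indicator A x \<partial>M) \<le> emeasure (density M g) (space M)"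
        by (auto simp: emeasure_density intro!: nn_integral_mono split: split_indicator)
      then show "(\<integral>\<^sup>+x. g x * indicator A x \<partial>M) \<noteq> \<infinity>" using fin by auto
      show "AE x in M. g x * indicator A x \<le> f x * indicator A x"
        by (rule AE_I2) (auto simp: A_def split: split_indicator)
    qed auto
    then show False using le[of A] by (simp add: emeasure_density)
  qed
  then show ?thesis
    by (rule AE_mp, intro AE_I2) (auto simp: A_def split: split_indicator_asm)
qed

lemma measure_eq_of_atMost_eq:
  fixes \<mu> \<nu> :: "real measure"
  assumes "sets \<mu> = sets borel" "sets \<nu> = sets borel"
    and "\<And>x. emeasure \<mu> {..x} = emeasure \<nu> {..x}" "\<And>x. emeasure \<mu> {..x} \<noteq> \<infinity>"
  shows "\<mu> = \<nu>"
proof (rule measure_eqI_generator_eq)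
  show "Int_stable (range (\<lambda>a::real. {..a}))"
    by (auto simp: Int_stable_def)
  show "sets \<mu> = sigma_sets UNIV (range (\<lambda>a. {..a}))" "sets \<nu> = sigma_sets UNIV (range (\<lambda>a. {..a}))"
    using assms(1,2) by (simp_all add: borel_eq_atMost)
  show "(\<Union>n. {..real n}) = UNIV"
    by (auto intro: real_arch_simple)
qed (use assms in auto)

text \<open>The conditional distribution functions of \<open>i\<close> given \<open>T\<close> are
  Radon-Nikodym derivatives, repaired on a null set so that every one is a genuine distribution
  function. The weight \<open>w\<close> expresses sufficiency: one kernel serves all finite measures
  whose density is a function of \<open>T\<close>.\<close>

lemma conditional_distribution_real:
  fixes T i :: "'b \<Rightarrow> real"
  assumes "finite_measure M" and T [measurable]: "T \<in> borel_measurable M"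
    and i [measurable]: "i \<in> borel_measurable M" and i01: "\<And>x. 0 \<le> i x \<and> i x \<le> 1"
  obtains k where "k \<in> borel \<rightarrow>\<^sub>M prob_algebra borel"
    "\<And>w. w \<in> borel_measurable borel \<Longrightarrow> (\<integral>\<^sup>+x. w (T x) \<partial>M) < \<infinity> \<Longrightarrow>
      distr (density M (\<lambda>x. w (T x))) borel T \<bind> k = distr (density M (\<lambda>x. w (T x))) borel i"
proof -
  interpret finite_measure M by fact
  define \<nu> where "\<nu> = distr M borel T"
  have [simp, measurable_cong]: "sets \<nu> = sets borel" by (simp add: \<nu>_def)
  have [simp]: "space \<nu> = UNIV" by (simp add: \<nu>_def)
  interpret \<nu>: finite_measure \<nu> unfolding \<nu>_def by (rule finite_measure_distr) simp
  \<comment> \<open>The law of \<open>T\<close> on the event \<open>i \<le> x\<close>, written with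
    \<open>density\<close> and \<open>distr\<close> so that integrals against it can be pulled back
    to \<open>M\<close>.\<close>
  define N where "N x = distr (density M (\<lambda>y. indicator {..x} (i y))) borel T" for x
  have [simp, measurable_cong]: "sets (N x) = sets borel" for x by (simp add: N_def)
  have N: "emeasure (N x) B = emeasure M {y \<in> space M. T y \<in> B \<and> i y \<le> x}"
    if [measurable]: "B \<in> sets borel" for B x
  proof -
    have "emeasure (N x) B = (\<integral>\<^sup>+y. indicator {..x} (i y) * indicator (T -` B \<inter> space M) y \<partial>M)"
      by (simp add: N_def emeasure_distr emeasure_density)
    also have "\<dots> = (\<integral>\<^sup>+y. indicator {y \<in> space M. T y \<in> B \<and> i y \<le> x} y \<partial>M)"
      by (intro nn_integral_cong) (auto split: split_indicator)
    also have "\<dots> = emeasure M {y \<in> space M. T y \<in> B \<and> i y \<le> x}"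
      by simp
    finally show ?thesis .
  qed
  have \<nu>: "emeasure \<nu> B = emeasure M {y \<in> space M. T y \<in> B}" if "B \<in> sets borel" for B
    unfolding \<nu>_def using that by (subst emeasure_distr) (auto intro!: arg_cong[where f = "emeasure M"])
  have N_mono: "emeasure (N x) B \<le> emeasure (N y) B" if "x \<le> y" "B \<in> sets borel" for x y B
    using that(2) by (auto simp: N intro!: emeasure_mono order_trans[OF _ that(1)])
  have N_\<nu>: "emeasure (N x) B \<le> emeasure \<nu> B" if "B \<in> sets borel" for x B
    using that by (auto simp: N \<nu> intro!: emeasure_mono)
  have N_fin: "emeasure (N x) B < \<infinity>" for x B
    by (cases "B \<in> sets borel") (simp_all add: N emeasure_notin_sets less_top[symmetric])
  \<comment> \<open>\<open>f x t\<close> is a version of the conditional probability of \<open>i \<le> x\<close> given \<open>T = t\<close>.\<close>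
  define f where "f x = RN_deriv \<nu> (N x)" for x
  have [measurable]: "f x \<in> borel_measurable borel" for x
    using borel_measurable_RN_deriv[of \<nu> "N x"] by (simp add: f_def cong: measurable_cong_sets)
  have dens: "density \<nu> (f x) = N x" for x
    unfolding f_def
  proof (rule \<nu>.density_RN_deriv)
    show "absolutely_continuous \<nu> (N x)"
      unfolding absolutely_continuous_def
    proof
      fix B assume "B \<in> null_sets \<nu>"
      then show "B \<in> null_sets (N x)" using N_\<nu>[of B x] by (auto simp: null_sets_def)
    qed
  qed simp
  have f_mono: "AE t in \<nu>. f x t \<le> f y t" if "x \<le> y" for x y
    by (rule \<nu>.AE_mono_of_density_le) (auto simp: dens N_fin[unfolded infinity_ennreal_def] N_mono[OF that])
  have f_one: "AE t in \<nu>. f x t = 1" if "1 \<le> x" for x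
  proof -
    have "density \<nu> (\<lambda>_. 1) = N x"
      using i01 that by (auto intro!: measure_eqI arg_cong[where f = "emeasure M"] simp: N \<nu> density_1)
        (meson order_trans)+
    then show ?thesis
      using \<nu>.RN_deriv_unique[of "\<lambda>_. 1" "N x"] by (auto simp: f_def)
  qed
  have f_zero: "AE t in \<nu>. f x t = 0" if "x < 0" for x
  proof -
    have "density \<nu> (\<lambda>_. 0) = N x"
    proof (rule measure_eqI)
      fix A assume "A \<in> sets (density \<nu> (\<lambda>_. 0))"
      moreover have "\<not> i y \<le> x" for y
        using i01[of y] that by linarith
      ultimately show "emeasure (density \<nu> (\<lambda>_. 0)) A = emeasure (N x) A"
        by (simp add: N emeasure_density)
    qed simp
    then show ?thesis
      using \<nu>.RN_deriv_unique[of "\<lambda>_. 0" "N x"] by (auto simp: f_def)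
  qed

  \<comment> \<open>Only countably many conditions, at rational arguments, are imposed, so the
    exceptional set stays null.\<close>
  define G where "G t \<longleftrightarrow> (\<forall>r s::rat. r \<le> s \<longrightarrow> f (of_rat r) t \<le> f (of_rat s) t) \<and>
    (\<forall>r::rat. 1 \<le> r \<longrightarrow> f (of_rat r) t = 1) \<and> (\<forall>r::rat. r < 0 \<longrightarrow> f (of_rat r) t = 0)" for t
  have [measurable]: "Measurable.pred borel G" unfolding G_def by measurable
  have AE_G: "AE t in \<nu>. G t"
    unfolding G_def
    by (intro AE_conjI; subst AE_all_countable; intro allI)
      (auto simp: AE_all_countable of_rat_less_eq one_le_of_rat_iff intro!: f_mono f_one f_zero)
  \<comment> \<open>For exceptional \<open>t\<close> the default is the distribution function of the
    point mass at 1, so that \<open>k t\<close> is a probability measure for every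
    \<open>t\<close>.\<close>
  define h where "h t r = (if G t then enn2real (f (of_rat r) t) else of_bool (1 \<le> r))" for t r
  have [measurable]: "(\<lambda>t. h t r) \<in> borel_measurable borel" for r
    unfolding h_def by measurable
  have f_le1: "f (of_rat r) t \<le> 1" if "G t" for r t
    using that unfolding G_def by (metis linorder_le_cases order_refl)
  have f_less_top: "f (of_rat r) t < \<top>" if "G t" for r t
    using f_le1[OF that] ennreal_one_less_top by (rule le_less_trans)
  have h_mono: "h t r \<le> h t s" if "r \<le> s" for t r s
  proof (cases "G t")
    case True
    then have "f (of_rat r) t \<le> f (of_rat s) t" using that by (simp add: G_def)
    then show ?thesis using True f_less_top by (simp add: h_def enn2real_mono)
  qed (use that in \<open>simp add: h_def\<close>)
  have h_one: "h t r = 1" if "1 \<le> r" for t r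
    using that by (auto simp: h_def G_def)
  have h_zero: "h t r = 0" if "r < 0" for t r
    using that by (auto simp: h_def G_def)
  define H where "H t x = (INF r\<in>{r. x < of_rat r}. h t r)" for t and x :: real
  have [measurable]: "(\<lambda>t. H t x) \<in> borel_measurable borel" for x
    unfolding H_def by (intro borel_measurable_cINF_real) auto
  define k where "k t = interval_measure (H t)" for t
  have k_dist: "real_distribution (k t)" and k_atMost: "emeasure (k t) {..x} = ennreal (H t x)" for t x
    using cdf_of_rational_cdf[of "h t", OF h_mono h_one h_zero] by (auto simp: k_def H_def[abs_def])
  have k: "k \<in> borel \<rightarrow>\<^sub>M prob_algebra borel"
  proof (rule measurable_prob_algebra_generated)
    show "sets borel = sigma_sets UNIV (range (\<lambda>a::real. {..a}))" by (simp add: borel_eq_atMost)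
    show "Int_stable (range (\<lambda>a::real. {..a}))" by (auto simp: Int_stable_def)
    show "prob_space (k t)" for t using k_dist by (simp add: real_distribution_def)
    show "sets (k t) = sets borel" for t by (simp add: k_def)
    show "(\<lambda>t. emeasure (k t) A) \<in> borel_measurable borel" if "A \<in> range (\<lambda>a. {..a})" for A
      using that by (auto simp: k_atMost)
  qed auto

  \<comment> \<open>Passing from \<open>f x\<close> to the right limit \<open>H\<close> loses
    nothing: almost everywhere \<open>f x t \<le> H t x \<le> f y t\<close> for a given
    \<open>y > x\<close>, and continuity of \<open>M\<close> from above closes the gap as
    \<open>y\<close> decreases to \<open>x\<close>.\<close>
  have H_dens: "density \<nu> (\<lambda>t. ennreal (H t x)) = N x" for x
  proof (rule measure_eqI)
    fix B assume "B \<in> sets (density \<nu> (\<lambda>t. ennreal (H t x)))"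
    then have [measurable]: "B \<in> sets borel" by simp
    have f_H: "f x t \<le> ennreal (H t x)"
      if "G t" "\<forall>r::rat. x < of_rat r \<longrightarrow> f x t \<le> f (of_rat r) t" for t
    proof -
      have "f x t \<le> 1"
        using that of_rat_dense[of x "x + 1"] f_le1[OF that(1)] by (meson less_add_one order_trans)
      then have fx: "f x t = ennreal (enn2real (f x t))"
        by (simp add: le_less_trans[OF _ ennreal_one_less_top])
      have "enn2real (f x t) \<le> H t x"
        unfolding H_def
      proof (rule cINF_greatest)
        show "{r. x < of_rat r} \<noteq> {}" using of_rat_dense[of x "x + 1"] by auto
        fix r :: rat assume "r \<in> {r. x < of_rat r}"
        then show "enn2real (f x t) \<le> h t r"
          using that f_less_top[OF that(1)] by (simp add: h_def enn2real_mono)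
      qed
      then show ?thesis by (subst fx) (rule ennreal_leI)
    qed
    have H_f: "ennreal (H t x) \<le> f y t"
      if "G t" "x < y" "\<forall>r::rat. of_rat r \<le> y \<longrightarrow> f (of_rat r) t \<le> f y t" for t y
    proof -
      obtain r where r: "x < of_rat r" "of_rat r < y" using of_rat_dense[OF \<open>x < y\<close>] by blast
      have h0: "0 \<le> h t s" for s by (simp add: h_def)
      have "H t x \<le> h t r"
        unfolding H_def using r h0 by (intro cINF_lower bdd_belowI2[of _ 0]) auto
      then have "ennreal (H t x) \<le> ennreal (h t r)" by (rule ennreal_leI)
      also have "\<dots> = f (of_rat r) t"
        using f_less_top that(1) by (simp add: h_def)
      also have "\<dots> \<le> f y t" using that r by simp
      finally show ?thesis .
    qed
    have dens_mono: "emeasure (density \<nu> u) B \<le> emeasure (density \<nu> v) B"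
      if [measurable]: "u \<in> borel_measurable borel" "v \<in> borel_measurable borel"
        and "AE t in \<nu>. u t \<le> v t" for u v
    proof -
      have "AE t in \<nu>. u t * indicator B t \<le> v t * indicator B t"
        using that(3) by (rule AE_mp) (auto intro!: AE_I2 mult_right_mono)
      then show ?thesis by (simp add: emeasure_density nn_integral_mono_AE)
    qed
    define y where "y n = x + 1 / real (Suc n)" for n
    have y: "x < y n" for n by (simp add: y_def)
    show "emeasure (density \<nu> (\<lambda>t. ennreal (H t x))) B = emeasure (N x) B"
    proof (rule antisym)
      have "AE t in \<nu>. G t \<and> (\<forall>r::rat. x < of_rat r \<longrightarrow> f x t \<le> f (of_rat r) t)"
        by (intro AE_conjI AE_G; subst AE_all_countable; intro allI) (auto intro!: f_mono)
      then have "AE t in \<nu>. f x t \<le> ennreal (H t x)"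
        by (rule AE_mp) (auto intro!: AE_I2 f_H)
      then have "emeasure (density \<nu> (f x)) B \<le> emeasure (density \<nu> (\<lambda>t. ennreal (H t x))) B"
        by (intro dens_mono) simp_all
      then show "emeasure (N x) B \<le> emeasure (density \<nu> (\<lambda>t. ennreal (H t x))) B"
        by (simp add: dens)
      have "emeasure (density \<nu> (\<lambda>t. ennreal (H t x))) B \<le> emeasure (N (y n)) B" for n
      proof -
        have "AE t in \<nu>. G t \<and> (\<forall>r::rat. of_rat r \<le> y n \<longrightarrow> f (of_rat r) t \<le> f (y n) t)"
          by (intro AE_conjI AE_G; subst AE_all_countable; intro allI) (auto intro!: f_mono)
        then have "AE t in \<nu>. ennreal (H t x) \<le> f (y n) t"
          by (rule AE_mp) (auto intro!: AE_I2 H_f y)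
        then have "emeasure (density \<nu> (\<lambda>t. ennreal (H t x))) B \<le> emeasure (density \<nu> (f (y n))) B"
          by (intro dens_mono) simp_all
        then show ?thesis by (simp add: dens)
      qed
      moreover have "(\<lambda>n. emeasure (N (y n)) B) \<longlonglongrightarrow> emeasure (N x) B"
      proof -
        let ?S = "\<lambda>z. {u \<in> space M. T u \<in> B \<and> i u \<le> z}"
        have "(\<lambda>n. emeasure M (?S (y n))) \<longlonglongrightarrow> emeasure M (\<Inter>n. ?S (y n))"
        proof (rule Lim_emeasure_decseq)
          show "decseq (\<lambda>n. ?S (y n))"
          proof (rule decseq_SucI)
            fix n
            have "y (Suc n) \<le> y n" by (simp add: y_def field_simps)
            then show "?S (y (Suc n)) \<subseteq> ?S (y n)" by auto
          qed
        qed auto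
        moreover have "(\<Inter>n. ?S (y n)) = ?S x"
        proof -
          have lim: "y \<longlonglongrightarrow> x"
            unfolding y_def using LIMSEQ_inverse_real_of_nat_add[of x] by (simp add: inverse_eq_divide)
          have "i u \<le> x \<longleftrightarrow> (\<forall>n. i u \<le> y n)" for u
            using LIMSEQ_le_const[OF lim, of "i u"] y by (meson less_imp_le order_trans)
          then show ?thesis by auto
        qed
        ultimately show ?thesis by (simp add: N)
      qed
      ultimately show "emeasure (density \<nu> (\<lambda>t. ennreal (H t x))) B \<le> emeasure (N x) B"
        by (intro LIMSEQ_le_const) auto
    qed
  qed simp

  show thesis
  proof (rule that[OF k])
    fix w :: "real \<Rightarrow> ennreal"
    assume [measurable]: "w \<in> borel_measurable borel" and w: "(\<integral>\<^sup>+x. w (T x) \<partial>M) < \<infinity>"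
    let ?D = "density M (\<lambda>x. w (T x))"
    have D: "emeasure ?D (space M) < \<infinity>"
      using w by (simp add: emeasure_density cong: nn_integral_cong_simp)
    have ks: "k \<in> borel \<rightarrow>\<^sub>M subprob_algebra borel" using k by (rule measurable_prob_algebraD)
    have eq: "emeasure (distr ?D borel T \<bind> k) {..x} = emeasure (distr ?D borel i) {..x}" for x
    proof -
      have "emeasure (distr ?D borel T \<bind> k) {..x} = (\<integral>\<^sup>+t. ennreal (H t x) \<partial>distr ?D borel T)"
        using ks by (subst emeasure_bind[where N = borel]) (auto simp: k_atMost)
      also have "\<dots> = (\<integral>\<^sup>+y. ennreal (H (T y) x) \<partial>?D)"
        by (rule nn_integral_distr) simp_all
      also have "\<dots> = (\<integral>\<^sup>+y. w (T y) * ennreal (H (T y) x) \<partial>M)"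
        by (subst nn_integral_density) auto
      also have "\<dots> = (\<integral>\<^sup>+t. w t * ennreal (H t x) \<partial>\<nu>)"
        unfolding \<nu>_def by (subst nn_integral_distr) auto
      \<comment> \<open>The roles are exchanged: \<open>w\<close> becomes the integrand and
        \<open>H\<close> the density, so that \<open>H_dens\<close> replaces the latter by
        \<open>N x\<close>.\<close>
      also have "\<dots> = (\<integral>\<^sup>+t. w t \<partial>density \<nu> (\<lambda>t. ennreal (H t x)))"
        by (subst nn_integral_density) (auto simp: mult.commute)
      also have "\<dots> = (\<integral>\<^sup>+y. w (T y) \<partial>density M (\<lambda>y. indicator {..x} (i y)))"
        unfolding H_dens N_def by (rule nn_integral_distr) simp_all
      also have "\<dots> = (\<integral>\<^sup>+y. indicator {..x} (i y) * w (T y) \<partial>M)"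
        by (subst nn_integral_density) auto
      also have "\<dots> = emeasure (distr ?D borel i) {..x}"
        by (subst emeasure_distr)
          (auto simp: emeasure_density intro!: nn_integral_cong split: split_indicator)
      finally show ?thesis .
    qed
    show "distr ?D borel T \<bind> k = distr ?D borel i"
    proof (rule measure_eq_of_atMost_eq)
      show "sets (distr ?D borel T \<bind> k) = sets borel"
        using ks by (intro sets_bind_measurable) auto
      fix x
      have "emeasure (distr ?D borel i) {..x} \<le> emeasure ?D (space M)"
        by (subst emeasure_distr) (auto intro!: emeasure_mono)
      then show "emeasure (distr ?D borel T \<bind> k) {..x} \<noteq> \<infinity>"
        using D eq by auto
    qed (use eq in auto)
  qed
qed

text \<open>The conditional law of the real code \<open>i\<close> given \<open>T\<close> is pushed
  back to the space by \<open>g\<close>. Since \<open>g\<close> inverts \<open>i\<close>, this is a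
  conditional law of the point itself.\<close>

lemma kernel_from_statistic:
  fixes N :: "'a measure" and T :: "'a \<Rightarrow> real"
  assumes "standard_borel N" "space N \<noteq> {}" and "finite_measure M" and sets_M: "sets M = sets N"
    and T [measurable]: "T \<in> borel_measurable M"
  obtains K where "K \<in> borel \<rightarrow>\<^sub>M prob_algebra N"
    "\<And>w. w \<in> borel_measurable borel \<Longrightarrow> (\<integral>\<^sup>+x. w (T x) \<partial>M) < \<infinity> \<Longrightarrow>
      distr (density M (\<lambda>x. w (T x))) borel T \<bind> K = density M (\<lambda>x. w (T x))"
proof -
  obtain i :: "'a \<Rightarrow> real" and g where i: "i \<in> borel_measurable N" "\<And>x. 0 \<le> i x \<and> i x \<le> 1"
    and g: "g \<in> borel \<rightarrow>\<^sub>M N" "\<And>x. x \<in> space N \<Longrightarrow> g (i x) = x"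
    using standard_borel_retract_real[OF assms(1,2)] by blast
  have iM: "i \<in> borel_measurable M" using i(1) sets_M by (simp cong: measurable_cong_sets)
  obtain k where k: "k \<in> borel \<rightarrow>\<^sub>M prob_algebra borel"
    and k_bind: "\<And>w. w \<in> borel_measurable borel \<Longrightarrow> (\<integral>\<^sup>+x. w (T x) \<partial>M) < \<infinity> \<Longrightarrow>
      distr (density M (\<lambda>x. w (T x))) borel T \<bind> k = distr (density M (\<lambda>x. w (T x))) borel i"
    using conditional_distribution_real[OF \<open>finite_measure M\<close> T iM i(2)] by blast
  show thesis
  proof (rule that)
    show "(\<lambda>t. distr (k t) N g) \<in> borel \<rightarrow>\<^sub>M prob_algebra N"
      using measurable_compose[OF k measurable_distr_prob_space[OF g(1)]] .
    fix w :: "real \<Rightarrow> ennreal"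
    assume w: "w \<in> borel_measurable borel" "(\<integral>\<^sup>+x. w (T x) \<partial>M) < \<infinity>"
    let ?D = "density M (\<lambda>x. w (T x))"
    have "distr ?D borel T \<bind> (\<lambda>t. distr (k t) N g) = distr (distr ?D borel T \<bind> k) N g"
      by (rule distr_bind[symmetric, where K = borel])
        (use k g in \<open>auto dest: measurable_prob_algebraD\<close>)
    also have "\<dots> = distr ?D N (g \<circ> i)"
      unfolding k_bind[OF w] using iM g(1) by (intro distr_distr) auto
    also have "\<dots> = distr ?D N (\<lambda>x. x)"
      using g(2) sets_eq_imp_space_eq[OF sets_M] by (intro distr_cong) auto
    also have "\<dots> = ?D"
      by (rule distr_id2) (simp add: sets_M)
    finally show "distr ?D borel T \<bind> (\<lambda>t. distr (k t) N g) = ?D" .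
  qed
qed

subsection \<open>Likelihood ratios and trade-off functions\<close>

text \<open>Densities normalised to sum to 1 make \<open>T\<close> a bounded substitute for the
  likelihood ratio \<open>T / (1 - T)\<close>, which could be infinite; mutually singular parts
  appear as \<open>T = 0\<close> and \<open>T = 1\<close>.\<close>

locale likelihood_pair = finite_measure M for M :: "'a measure" and T :: "'a \<Rightarrow> real" +
  assumes T_meas [measurable]: "T \<in> borel_measurable M"
    and T_bounds: "0 \<le> T x" "T x \<le> 1"
    and prob_null: "prob_space (density M (\<lambda>x. ennreal (1 - T x)))"
    and prob_alt: "prob_space (density M (\<lambda>x. ennreal (T x)))"
begin

abbreviation (input) "P \<equiv> density M (\<lambda>x. ennreal (1 - T x))"
abbreviation (input) "Q \<equiv> density M (\<lambda>x. ennreal (T x))"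

text \<open>The stop-loss transform of the law of \<open>T\<close>; for \<open>0 \<le> r < 1\<close>
  it is, up to scaling, a hockey-stick divergence between \<open>Q\<close> and
  \<open>P\<close>.\<close>

definition hinge :: "real \<Rightarrow> real" where
  "hinge r = (\<integral>x. max 0 (T x - r) \<partial>M)"

lemma integrable_bounded:
  fixes u :: "'a \<Rightarrow> real"
  assumes "u \<in> borel_measurable M" "\<And>x. x \<in> space M \<Longrightarrow> \<bar>u x\<bar> \<le> B"
  shows "integrable M u"
  using assms by (intro integrable_const_bound[of u B]) auto

lemma hinge_integrable: "integrable M (\<lambda>x. max 0 (T x - r))"
proof (rule integrable_bounded[where B = "1 + \<bar>r\<bar>"])
  show "\<bar>max 0 (T x - r)\<bar> \<le> 1 + \<bar>r\<bar>" for x using T_bounds[of x] by auto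
qed simp

lemma integral_T: "(\<integral>x. T x \<partial>M) = 1"
proof -
  interpret Q: prob_space Q by (rule prob_alt)
  have "(\<integral>x. (1::real) \<partial>Q) = (\<integral>x. T x *\<^sub>R 1 \<partial>M)" by (rule integral_density) (auto simp: T_bounds)
  then show ?thesis using Q.prob_space by simp
qed

lemma total_mass: "measure M (space M) = 2"
proof -
  interpret P: prob_space P by (rule prob_null)
  have "(\<integral>x. (1::real) \<partial>P) = (\<integral>x. (1 - T x) *\<^sub>R 1 \<partial>M)" by (rule integral_density) (auto simp: T_bounds)
  then have "1 = (\<integral>x. 1 - T x \<partial>M)" using P.prob_space by simp
  also have "\<dots> = (\<integral>x. 1 \<partial>M) - (\<integral>x. T x \<partial>M)"
    using T_bounds by (intro Bochner_Integration.integral_diff integrable_bounded[where B = 1]) auto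
  finally show ?thesis using integral_T by simp
qed

lemma integral_rejection:
  assumes "rejection_rule M \<phi>"
  shows "integral\<^sup>L Q \<phi> = (\<integral>x. T x * \<phi> x \<partial>M)" "integral\<^sup>L P \<phi> = (\<integral>x. (1 - T x) * \<phi> x \<partial>M)"
    "integrable M (\<lambda>x. T x * \<phi> x)" "integrable M (\<lambda>x. (1 - T x) * \<phi> x)"
proof -
  have [measurable]: "\<phi> \<in> borel_measurable M" and \<phi>: "\<And>x. x \<in> space M \<Longrightarrow> 0 \<le> \<phi> x \<and> \<phi> x \<le> 1"
    using assms by (auto simp: rejection_rule_def)
  show "integral\<^sup>L Q \<phi> = (\<integral>x. T x * \<phi> x \<partial>M)" "integral\<^sup>L P \<phi> = (\<integral>x. (1 - T x) * \<phi> x \<partial>M)"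
    by (subst integral_density; simp add: T_bounds)+
  show "integrable M (\<lambda>x. T x * \<phi> x)" "integrable M (\<lambda>x. (1 - T x) * \<phi> x)"
    using T_bounds \<phi> by (auto intro!: integrable_bounded[where B = 1] simp: abs_mult mult_le_one)
qed

text \<open>Pointwise \<open>(1 - r) * T - r * (1 - T) = T - r\<close>, which turns the weighted
  difference into a single integral against \<open>M\<close>.\<close>

lemma rejection_advantage:
  assumes "rejection_rule M \<phi>"
  shows "(1 - r) * integral\<^sup>L Q \<phi> - r * integral\<^sup>L P \<phi> = (\<integral>x. (T x - r) * \<phi> x \<partial>M)"
    "integrable M (\<lambda>x. (T x - r) * \<phi> x)"
proof -
  note I = integral_rejection[OF assms]
  have eq: "(\<lambda>x. (T x - r) * \<phi> x) = (\<lambda>x. (1 - r) * (T x * \<phi> x) - r * ((1 - T x) * \<phi> x))"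
    by (auto simp: algebra_simps)
  show "(1 - r) * integral\<^sup>L Q \<phi> - r * integral\<^sup>L P \<phi> = (\<integral>x. (T x - r) * \<phi> x \<partial>M)"
    unfolding eq using I by simp
  show "integrable M (\<lambda>x. (T x - r) * \<phi> x)"
    unfolding eq using I by (intro Bochner_Integration.integrable_diff integrable_mult_right) auto
qed

text \<open>Neyman-Pearson bound: with values between 0 and 1, a rule gains at each point no more
  than the positive part of \<open>T x - r\<close>.\<close>

lemma rejection_advantage_le_hinge:
  assumes "rejection_rule M \<phi>"
  shows "(1 - r) * integral\<^sup>L Q \<phi> - r * integral\<^sup>L P \<phi> \<le> hinge r"
  unfolding rejection_advantage[OF assms] hinge_def
proof (intro integral_mono rejection_advantage[OF assms] hinge_integrable)
  fix x assume "x \<in> space M"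
  then have \<phi>: "0 \<le> \<phi> x" "\<phi> x \<le> 1" using assms by (auto simp: rejection_rule_def)
  have "(T x - r) * \<phi> x \<le> max 0 (T x - r) * \<phi> x" using \<phi> by (intro mult_right_mono) auto
  also have "\<dots> \<le> max 0 (T x - r) * 1" using \<phi> by (intro mult_left_mono) auto
  finally show "(T x - r) * \<phi> x \<le> max 0 (T x - r)" by simp
qed

text \<open>Rejecting exactly where \<open>r < T x\<close> turns the Neyman-Pearson bound into an
  equality.\<close>

lemma likelihood_ratio_test:
  obtains \<phi> where "rejection_rule M \<phi>" "(1 - r) * integral\<^sup>L Q \<phi> - r * integral\<^sup>L P \<phi> = hinge r"
proof -
  define \<phi> :: "'a \<Rightarrow> real" where "\<phi> = indicator {x \<in> space M. r < T x}"
  have \<phi>: "rejection_rule M \<phi>" by (auto simp: rejection_rule_def \<phi>_def split: split_indicator)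
  have "(\<integral>x. (T x - r) * \<phi> x \<partial>M) = hinge r"
    unfolding hinge_def \<phi>_def
    by (rule Bochner_Integration.integral_cong) (auto split: split_indicator)
  then show ?thesis
    by (intro that[OF \<phi>]) (simp only: rejection_advantage(1)[OF \<phi>])
qed

lemma rejection_probability_bounds:
  assumes "rejection_rule M \<phi>"
  shows "0 \<le> integral\<^sup>L P \<phi>" "integral\<^sup>L P \<phi> \<le> 1" "integral\<^sup>L Q \<phi> \<le> 1"
proof -
  interpret P: prob_space P by (rule prob_null)
  interpret Q: prob_space Q by (rule prob_alt)
  have \<phi>: "\<phi> \<in> borel_measurable M" "\<And>x. x \<in> space M \<Longrightarrow> 0 \<le> \<phi> x \<and> \<phi> x \<le> 1"
    using assms by (auto simp: rejection_rule_def)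
  show "0 \<le> integral\<^sup>L P \<phi>" using \<phi> by (intro integral_nonneg_AE AE_I2) auto
  have "integral\<^sup>L P \<phi> \<le> (\<integral>x. 1 \<partial>P)" "integral\<^sup>L Q \<phi> \<le> (\<integral>x. 1 \<partial>Q)"
    using \<phi> by (intro integral_mono P.integrable_const_bound[of _ 1] Q.integrable_const_bound[of _ 1]; auto)+
  then show "integral\<^sup>L P \<phi> \<le> 1" "integral\<^sup>L Q \<phi> \<le> 1"
    using P.prob_space Q.prob_space by auto
qed

lemma rejection_rule_null: "rejection_rule P = rejection_rule M"
  by (auto simp: fun_eq_iff rejection_rule_def)

lemma trade_off_bdd: "bdd_below ((\<lambda>\<phi>. 1 - integral\<^sup>L Q \<phi>) ` {\<phi>. rejection_rule P \<phi> \<and> integral\<^sup>L P \<phi> \<le> \<alpha>})"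
  by (rule bdd_belowI2[where m = 0]) (auto simp: rejection_rule_null rejection_probability_bounds)

lemma trade_off_le:
  assumes "rejection_rule M \<phi>"
  shows "trade_off P Q (integral\<^sup>L P \<phi>) \<le> 1 - integral\<^sup>L Q \<phi>"
proof -
  have "trade_off P Q (integral\<^sup>L P \<phi>) =
      (INF \<psi>\<in>{\<psi>. rejection_rule P \<psi> \<and> integral\<^sup>L P \<psi> \<le> integral\<^sup>L P \<phi>}. 1 - integral\<^sup>L Q \<psi>)"
    using rejection_probability_bounds[OF assms] by (simp add: trade_off_def)
  also have "\<dots> \<le> 1 - integral\<^sup>L Q \<phi>"
    by (rule cINF_lower[OF trade_off_bdd]) (simp add: rejection_rule_null assms)
  finally show ?thesis .
qed

lemma trade_off_approx:
  assumes "0 \<le> \<alpha>" "\<alpha> \<le> 1" "trade_off P Q \<alpha> < c"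
  obtains \<phi> where "rejection_rule M \<phi>" "integral\<^sup>L P \<phi> \<le> \<alpha>" "1 - integral\<^sup>L Q \<phi> < c"
proof -
  have "(\<lambda>_. 0) \<in> {\<phi>. rejection_rule P \<phi> \<and> integral\<^sup>L P \<phi> \<le> \<alpha>}"
    using assms by (auto simp: rejection_rule_def)
  then have "\<exists>\<phi>\<in>{\<phi>. rejection_rule P \<phi> \<and> integral\<^sup>L P \<phi> \<le> \<alpha>}. 1 - integral\<^sup>L Q \<phi> < c"
    using assms trade_off_bdd
    by (subst cINF_less_iff[symmetric]) (auto simp: trade_off_def)
  then show ?thesis using that by (auto simp: rejection_rule_null)
qed

text \<open>The negated right-hand difference quotients of \<open>max 0 (T x - r)\<close> in
  \<open>r\<close> are eventually 1 if \<open>r < T x\<close> and always 0 otherwise. They are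
  bounded by 1, so dominated convergence applies on the finite measure \<open>M\<close>.\<close>

lemma hinge_slope_tendsto:
  "(\<lambda>n. real (Suc n) * (hinge r - hinge (r + 1 / real (Suc n)))) \<longlonglongrightarrow> measure M {x \<in> space M. r < T x}"
proof -
  define q where "q n x = real (Suc n) * (max 0 (T x - r) - max 0 (T x - (r + 1 / real (Suc n))))" for n x
  have q_bound: "\<bar>q n x\<bar> \<le> 1" for n x
  proof -
    let ?z = "max 0 (T x - r) - max 0 (T x - (r + 1 / real (Suc n)))"
    have "0 < 1 / real (Suc n)" by simp
    then have z: "0 \<le> ?z" "?z \<le> 1 / real (Suc n)" by linarith+
    have "0 \<le> q n x"
      unfolding q_def by (intro mult_nonneg_nonneg of_nat_0_le_iff z)
    moreover have "q n x \<le> real (Suc n) * (1 / real (Suc n))"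
      unfolding q_def by (intro mult_left_mono of_nat_0_le_iff z)
    ultimately have "0 \<le> q n x" "q n x \<le> 1" by simp_all
    then show ?thesis by simp
  qed
  have "(\<lambda>n. \<integral>x. q n x \<partial>M) \<longlonglongrightarrow> (\<integral>x. indicator {x \<in> space M. r < T x} x \<partial>M)"
  proof (rule integral_dominated_convergence[where w = "\<lambda>_. 1"])
    show "AE x in M. (\<lambda>n. q n x) \<longlonglongrightarrow> indicator {x \<in> space M. r < T x} x"
    proof (rule AE_I2)
      fix x assume x: "x \<in> space M"
      show "(\<lambda>n. q n x) \<longlonglongrightarrow> indicator {x \<in> space M. r < T x} x"
      proof (cases "r < T x")
        case True
        then obtain n0 where n0: "1 / real (Suc n0) < T x - r"
          using nat_approx_posE[of "T x - r"] by auto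
        have "q n x = 1" if "n \<ge> n0" for n
        proof -
          have "1 / real (Suc n) \<le> 1 / real (Suc n0)" using that by (simp add: frac_le)
          then have "max 0 (T x - r) - max 0 (T x - (r + 1 / real (Suc n))) = 1 / real (Suc n)"
            using n0 True by linarith
          then show ?thesis by (simp add: q_def)
        qed
        then show ?thesis
          using True x by (intro tendsto_eventually) (auto simp: eventually_sequentially)
      next
        case False
        have "q n x = 0" for n
        proof -
          have "0 < 1 / real (Suc n)" by simp
          then have "max 0 (T x - r) - max 0 (T x - (r + 1 / real (Suc n))) = 0"
            using False by linarith
          then show ?thesis by (simp add: q_def)
        qed
        then show ?thesis using False by simp
      qed
    qed
  qed (use q_bound in \<open>auto simp: q_def[abs_def] simp del: of_nat_Suc\<close>)
  moreover have "(\<integral>x. q n x \<partial>M) = real (Suc n) * (hinge r - hinge (r + 1 / real (Suc n)))" for n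
    unfolding q_def hinge_def using hinge_integrable by simp
  ultimately show ?thesis by (simp del: of_nat_Suc)
qed

text \<open>Comparing tests requires the weights \<open>r\<close> and \<open>1 - r\<close> to be
  nonnegative. Beyond the unit interval the value is the same for every pair, by
  \<open>T_bounds\<close>, \<open>integral_T\<close> and \<open>total_mass\<close>.\<close>

lemma hinge_outside:
  "r < 0 \<Longrightarrow> hinge r = 1 - 2 * r" "1 \<le> r \<Longrightarrow> hinge r = 0"
proof -
  assume "r < 0"
  then have "max 0 (T x - r) = T x - r" for x using T_bounds[of x] by simp
  then have "hinge r = (\<integral>x. T x - r \<partial>M)" by (simp add: hinge_def)
  also have "\<dots> = (\<integral>x. T x \<partial>M) - (\<integral>x. r \<partial>M)"
    using T_bounds by (intro Bochner_Integration.integral_diff integrable_bounded[where B = 1] integrable_const) auto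
  finally show "hinge r = 1 - 2 * r" by (simp add: integral_T total_mass)
next
  assume "1 \<le> r"
  then have "max 0 (T x - r) = 0" for x using T_bounds[of x] by auto
  then show "hinge r = 0" by (simp add: hinge_def)
qed

end

section \<open>Two pairs with the same trade-off function\<close>

text \<open>Equal trade-off functions provide, for the optimal test of the first pair, a test of the
  second pair that is as good up to \<open>e\<close>; as both weights are nonnegative, its advantage
  drops by at most \<open>e\<close>. The slack \<open>e\<close> avoids the question whether the
  infimum is attained.\<close>

lemma hinge_le_of_trade_off_eq:
  assumes "likelihood_pair M T" "likelihood_pair M' T'"
    and eq: "trade_off (density M (\<lambda>x. ennreal (1 - T x))) (density M (\<lambda>x. ennreal (T x))) =
      trade_off (density M' (\<lambda>x. ennreal (1 - T' x))) (density M' (\<lambda>x. ennreal (T' x)))"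
    and r: "0 \<le> r" "r \<le> 1"
  shows "likelihood_pair.hinge M T r \<le> likelihood_pair.hinge M' T' r"
proof -
  interpret A: likelihood_pair M T by fact
  interpret B: likelihood_pair M' T' by fact
  obtain \<phi> where \<phi>: "rejection_rule M \<phi>"
    "(1 - r) * integral\<^sup>L A.Q \<phi> - r * integral\<^sup>L A.P \<phi> = A.hinge r"
    using A.likelihood_ratio_test by blast
  show ?thesis
  proof (rule field_le_epsilon)
    fix e :: real assume "e > 0"
    then have "trade_off B.P B.Q (integral\<^sup>L A.P \<phi>) < 1 - integral\<^sup>L A.Q \<phi> + e"
      using A.trade_off_le[OF \<phi>(1)] eq by simp
    then obtain \<psi> where \<psi>: "rejection_rule M' \<psi>" "integral\<^sup>L B.P \<psi> \<le> integral\<^sup>L A.P \<phi>"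
      "1 - integral\<^sup>L B.Q \<psi> < 1 - integral\<^sup>L A.Q \<phi> + e"
      using B.trade_off_approx A.rejection_probability_bounds[OF \<phi>(1)] by metis
    have "(1 - r) * integral\<^sup>L A.Q \<phi> \<le> (1 - r) * (integral\<^sup>L B.Q \<psi> + e)"
      using \<psi> r by (intro mult_left_mono) auto
    moreover have "r * integral\<^sup>L B.P \<psi> \<le> r * integral\<^sup>L A.P \<phi>"
      using \<psi> r by (intro mult_left_mono) auto
    moreover have "(1 - r) * e \<le> 1 * e" using r \<open>e > 0\<close> by (intro mult_right_mono) auto
    ultimately have "A.hinge r \<le> (1 - r) * integral\<^sup>L B.Q \<psi> - r * integral\<^sup>L B.P \<psi> + e"
      using \<phi>(2) by (simp add: algebra_simps)
    then show "A.hinge r \<le> B.hinge r + e"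
      using B.rejection_advantage_le_hinge[OF \<psi>(1), of r] by simp
  qed
qed

text \<open>Comparison in both directions equates the hinges, their slopes equate the upper tails,
  and the common total mass 2 turns the tails into distribution functions.\<close>

lemma distr_likelihood_eq_of_trade_off_eq:
  assumes "likelihood_pair M T" "likelihood_pair M' T'"
    and eq: "trade_off (density M (\<lambda>x. ennreal (1 - T x))) (density M (\<lambda>x. ennreal (T x))) =
      trade_off (density M' (\<lambda>x. ennreal (1 - T' x))) (density M' (\<lambda>x. ennreal (T' x)))"
  shows "distr M borel T = distr M' borel T'"
proof -
  interpret A: likelihood_pair M T by fact
  interpret B: likelihood_pair M' T' by fact
  have "A.hinge r = B.hinge r" for r
  proof (cases "0 \<le> r \<and> r \<le> 1")
    case True
    then show ?thesis
      using hinge_le_of_trade_off_eq[OF assms(1,2) eq, of r]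
        hinge_le_of_trade_off_eq[OF assms(2,1) eq[symmetric], of r] by linarith
  next
    case False
    then show ?thesis by (cases "r < 0") (auto simp: A.hinge_outside B.hinge_outside)
  qed
  then have upper: "measure M {x \<in> space M. r < T x} = measure M' {x \<in> space M'. r < T' x}" for r
    using LIMSEQ_unique[OF A.hinge_slope_tendsto[of r]] B.hinge_slope_tendsto[of r] by simp
  show ?thesis
  proof (rule measure_eq_of_atMost_eq)
    fix r
    have "{x \<in> space M. T x \<le> r} = space M - {x \<in> space M. r < T x}"
      "{x \<in> space M'. T' x \<le> r} = space M' - {x \<in> space M'. r < T' x}" by auto
    then have "measure M {x \<in> space M. T x \<le> r} = measure M' {x \<in> space M'. T' x \<le> r}"
      using A.T_meas B.T_meas
      by (simp add: A.finite_measure_compl B.finite_measure_compl A.total_mass B.total_mass upper)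
    moreover have "T -` {..r} \<inter> space M = {x \<in> space M. T x \<le> r}"
      "T' -` {..r} \<inter> space M' = {x \<in> space M'. T' x \<le> r}" by auto
    ultimately show "emeasure (distr M borel T) {..r} = emeasure (distr M' borel T') {..r}"
      by (simp add: emeasure_distr A.emeasure_eq_measure B.emeasure_eq_measure)
    show "emeasure (distr M borel T) {..r} \<noteq> \<infinity>"
      by (simp add: emeasure_distr A.emeasure_eq_measure)
  qed simp_all
qed

text \<open>For \<open>M = P + Q\<close>, the measure \<open>Q\<close> lies below \<open>M\<close>,
  so its derivative is at most 1 almost everywhere. Cancelling the finite \<open>Q\<close> then
  leaves the complementary density for \<open>P\<close>.\<close>

lemma likelihood_pair_exists:
  assumes "prob_space P" "prob_space Q" and sets_eq: "sets P = sets Q"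
  obtains M T where "likelihood_pair M T" "sets M = sets P"
    "P = density M (\<lambda>x. ennreal (1 - T x))" "Q = density M (\<lambda>x. ennreal (T x))"
proof -
  interpret P: prob_space P by fact
  interpret Q: prob_space Q by fact
  define M where "M = measure_of (space P) (sets P) (\<lambda>A. emeasure P A + emeasure Q A)"
  have sets_M [simp, measurable_cong]: "sets M = sets P" and space_M: "space M = space P"
    by (simp_all add: M_def)
  have M: "emeasure M A = emeasure P A + emeasure Q A" if "A \<in> sets P" for A
    unfolding M_def
  proof (rule emeasure_measure_of_sigma)
    show "sigma_algebra (space P) (sets P)" by (rule sets.sigma_algebra_axioms)
    show "positive (sets P) (\<lambda>A. emeasure P A + emeasure Q A)" by (simp add: positive_def)
    show "countably_additive (sets P) (\<lambda>A. emeasure P A + emeasure Q A)"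
      unfolding countably_additive_def
    proof (intro allI impI)
      fix A :: "nat \<Rightarrow> 'a set" assume A: "range A \<subseteq> sets P" "disjoint_family A"
      have "(\<Sum>i. emeasure P (A i) + emeasure Q (A i)) = (\<Sum>i. emeasure P (A i)) + (\<Sum>i. emeasure Q (A i))"
        by (rule suminf_add[symmetric]) auto
      then show "(\<Sum>i. emeasure P (A i) + emeasure Q (A i)) = emeasure P (\<Union>i. A i) + emeasure Q (\<Union>i. A i)"
        using A sets_eq by (simp add: suminf_emeasure)
    qed
  qed fact
  have spaces: "space Q = space P" using sets_eq_imp_space_eq[OF sets_eq] by simp
  interpret M: finite_measure M
    by standard (use P.emeasure_space_1 Q.emeasure_space_1 in \<open>simp add: M space_M spaces\<close>)
  define q where "q = RN_deriv M Q"
  have [measurable]: "q \<in> borel_measurable M" by (simp add: q_def)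
  have q: "density M q = Q"
    unfolding q_def
  proof (rule M.density_RN_deriv)
    show "absolutely_continuous M Q"
      unfolding absolutely_continuous_def using sets_eq by (auto simp: null_sets_def M)
  qed (simp add: sets_eq)
  have q_le: "AE x in M. q x \<le> 1"
    by (rule M.AE_mono_of_density_le)
      (auto simp: q M density_1 less_top[symmetric] intro: add_increasing)
  \<comment> \<open>Truncation changes \<open>q\<close> only on a null set and makes the bounds hold
    at every point, as the locale demands.\<close>
  define T where "T x = enn2real (min 1 (q x))" for x
  have T_meas [measurable]: "T \<in> borel_measurable M" unfolding T_def by measurable
  have T_bounds: "0 \<le> T x \<and> T x \<le> 1" for x
    using enn2real_mono[of "min 1 (q x)" 1] by (simp add: T_def)
  have "AE x in M. q x = ennreal (T x)"
    using q_le by (rule AE_mp) (auto intro!: AE_I2 simp: T_def min_absorb2 le_less_trans[OF _ ennreal_one_less_top])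
  then have "density M q = density M (\<lambda>x. ennreal (T x))"
    by (intro density_cong) auto
  then have Q: "Q = density M (\<lambda>x. ennreal (T x))" by (simp add: q)
  have P: "P = density M (\<lambda>x. ennreal (1 - T x))"
  proof (rule measure_eqI)
    fix A assume [measurable]: "A \<in> sets P"
    have "ennreal (1 - T x) + ennreal (T x) = 1" for x
      using T_bounds[of x] by (simp flip: ennreal_plus)
    then have "emeasure M A = (\<integral>\<^sup>+x. (ennreal (1 - T x) + ennreal (T x)) * indicator A x \<partial>M)"
      by simp
    also have "\<dots> = emeasure (density M (\<lambda>x. ennreal (1 - T x))) A + emeasure Q A"
      by (subst Q) (simp add: emeasure_density distrib_right nn_integral_add)
    finally have "emeasure Q A + emeasure P A = emeasure Q A + emeasure (density M (\<lambda>x. ennreal (1 - T x))) A"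
      by (simp add: M add.commute)
    then show "emeasure P A = emeasure (density M (\<lambda>x. ennreal (1 - T x))) A"
      by (simp add: ennreal_add_left_cancel)
  qed simp
  have "prob_space (density M (\<lambda>x. ennreal (1 - T x)))" "prob_space (density M (\<lambda>x. ennreal (T x)))"
    using assms(1,2) unfolding P[symmetric] Q[symmetric] .
  then have "likelihood_pair M T"
    by (intro likelihood_pair.intro likelihood_pair_axioms.intro M.finite_measure_axioms T_meas)
      (use T_bounds in auto)
  then show thesis by (rule that[OF _ sets_M P Q])
qed

section \<open>Post-processing one pair into the other\<close>

text \<open>The kernel evaluates the statistic \<open>T\<close> of the first pair and then samples
  from the conditional distribution of the second pair given \<open>T'\<close>. Feeding
  \<open>T\<close> into a kernel made for \<open>T'\<close> is legitimate because the two statistics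
  have the same law.\<close>

lemma kernel_of_trade_off_eq:
  assumes PQ: "distributions_on_same_space P Q"
    and N: "standard_borel N" "P' \<in> space (prob_algebra N)" "Q' \<in> space (prob_algebra N)"
    and eq: "trade_off P Q = trade_off P' Q'"
  obtains K where "K \<in> P \<rightarrow>\<^sub>M prob_algebra N" "P \<bind> K = P'" "Q \<bind> K = Q'"
proof -
  have "prob_space P" "prob_space Q" "sets P = sets Q"
    using PQ by (auto simp: distributions_on_same_space_def space_prob_algebra)
  then obtain M T where MT: "likelihood_pair M T" "sets M = sets P"
    and P: "P = density M (\<lambda>x. ennreal (1 - T x))" and Q: "Q = density M (\<lambda>x. ennreal (T x))"
    by (rule likelihood_pair_exists)
  have P'Q': "prob_space P'" "prob_space Q'" "sets P' = sets Q'" "sets P' = sets N"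
    using N by (auto simp: space_prob_algebra)
  obtain M' T' where MT': "likelihood_pair M' T'" "sets M' = sets P'"
    and P': "P' = density M' (\<lambda>x. ennreal (1 - T' x))" and Q': "Q' = density M' (\<lambda>x. ennreal (T' x))"
    by (rule likelihood_pair_exists[OF P'Q'(1-3)])
  interpret A: likelihood_pair M T by fact
  interpret B: likelihood_pair M' T' by fact
  have law: "distr M borel T = distr M' borel T'"
    using distr_likelihood_eq_of_trade_off_eq[OF MT(1) MT'(1)] eq by (simp add: P Q P' Q')
  have not_empty: "space N \<noteq> {}"
    using prob_space.not_empty[OF P'Q'(1)] sets_eq_imp_space_eq[OF P'Q'(4)] by simp
  have sets_M': "sets M' = sets N" using MT'(2) P'Q'(4) by simp
  obtain K where K: "K \<in> borel \<rightarrow>\<^sub>M prob_algebra N"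
    "\<And>w. w \<in> borel_measurable borel \<Longrightarrow> (\<integral>\<^sup>+x. w (T' x) \<partial>M') < \<infinity> \<Longrightarrow>
      distr (density M' (\<lambda>x. w (T' x))) borel T' \<bind> K = density M' (\<lambda>x. w (T' x))"
    using kernel_from_statistic[OF N(1) not_empty B.finite_measure_axioms sets_M' B.T_meas] by blast
  \<comment> \<open>Stated for a general weight so that one \<open>K\<close> handles both
    hypotheses: \<open>1 - t\<close> gives the null distribution and \<open>t\<close> the
    alternative.\<close>
  have transport: "density M (\<lambda>x. w (T x)) \<bind> (\<lambda>x. K (T x)) = density M' (\<lambda>x. w (T' x))"
    if [measurable]: "w \<in> borel_measurable borel" and prob: "prob_space (density M' (\<lambda>x. w (T' x)))"
      "prob_space (density M (\<lambda>x. w (T x)))" for w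
  proof -
    have "(\<integral>\<^sup>+x. w (T' x) \<partial>M') = 1"
      using prob_space.emeasure_space_1[OF prob(1)] by (simp add: emeasure_density cong: nn_integral_cong_simp)
    then have fin: "(\<integral>\<^sup>+x. w (T' x) \<partial>M') < \<infinity>" by simp
    have "density M (\<lambda>x. w (T x)) \<bind> (\<lambda>x. K (T x)) = distr (density M (\<lambda>x. w (T x))) borel T \<bind> K"
      using measurable_prob_algebraD[OF K(1)] prob_space.not_empty[OF prob(2)]
      by (intro bind_distr[symmetric, where K = N]) auto
    also have "distr (density M (\<lambda>x. w (T x))) borel T = distr (density M' (\<lambda>x. w (T' x))) borel T'"
      using density_distr[OF that(1) A.T_meas] density_distr[OF that(1) B.T_meas] law by simp
    also have "\<dots> \<bind> K = density M' (\<lambda>x. w (T' x))"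
      by (rule K(2)) (use fin in auto)
    finally show ?thesis .
  qed
  show thesis
  proof (rule that)
    show "(\<lambda>x. K (T x)) \<in> P \<rightarrow>\<^sub>M prob_algebra N"
      using measurable_compose[OF A.T_meas K(1)] by (simp add: P)
    show "P \<bind> (\<lambda>x. K (T x)) = P'"
      unfolding P P' by (rule transport[where w = "\<lambda>t. ennreal (1 - t)"]) (auto intro: A.prob_null B.prob_null)
    show "Q \<bind> (\<lambda>x. K (T x)) = Q'"
      unfolding Q Q' by (rule transport[where w = "\<lambda>t. ennreal t"]) (auto intro: A.prob_alt B.prob_alt)
  qed
qed

lemma post_processing_le_of_trade_off_eq:
  assumes "post_processing_axiom D" "distributions_on_same_space P Q" "distributions_on_same_space P' Q'"
    and "trade_off P Q = trade_off P' Q'"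
  shows "D P' Q' \<le> D P Q"
proof -
  obtain N where N: "standard_borel N" "P' \<in> space (prob_algebra N)" "Q' \<in> space (prob_algebra N)"
    using assms(3) by (auto simp: distributions_on_same_space_def)
  obtain K where "K \<in> P \<rightarrow>\<^sub>M prob_algebra N" "P \<bind> K = P'" "Q \<bind> K = Q'"
    using kernel_of_trade_off_eq[OF assms(2) N assms(4)] .
  then show ?thesis
    using assms(1,2) N(1) unfolding post_processing_axiom_def by metis
qed

theorem mainTheorem1:
  fixes dp :: "'xi::order \<Rightarrow> ('r list \<Rightarrow> 'a measure) \<Rightarrow> bool"
    and D :: "'a measure \<Rightarrow> 'a measure \<Rightarrow> 'xi"
  assumes "hypothesis_testing_axiom dp D"
    and "post_processing_axiom D"
  shows "\<exists>d :: (real \<Rightarrow> real) \<Rightarrow> 'xi.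
           \<forall>P Q. distributions_on_same_space P Q \<longrightarrow> D P Q = d (trade_off P Q)"
proof -
  have D_eq: "D P Q = D P' Q'"
    if "distributions_on_same_space P Q" "distributions_on_same_space P' Q'"
      "trade_off P Q = trade_off P' Q'" for P Q P' Q'
    using post_processing_le_of_trade_off_eq[OF assms(2)] that by (metis order_antisym)
  \<comment> \<open>By \<open>D_eq\<close> the choice of the pair does not matter; at functions that
    come from no pair the value is arbitrary.\<close>
  define d where "d f = (SOME z. \<exists>P Q. distributions_on_same_space P Q \<and> trade_off P Q = f \<and> z = D P Q)" for f
  have "D P Q = d (trade_off P Q)" if "distributions_on_same_space P Q" for P Q
    unfolding d_def
  proof (rule someI2_ex)
    show "\<exists>z P' Q'. distributions_on_same_space P' Q' \<and> trade_off P' Q' = trade_off P Q \<and> z = D P' Q'"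
      using that by blast
  next
    fix z
    assume "\<exists>P' Q'. distributions_on_same_space P' Q' \<and> trade_off P' Q' = trade_off P Q \<and> z = D P' Q'"
    then obtain P' Q' where "distributions_on_same_space P' Q'" "trade_off P' Q' = trade_off P Q" "z = D P' Q'"
      by blast
    then show "D P Q = z" using D_eq[of P Q P' Q'] that by simp
  qed
  then show ?thesis by blast
qed

end
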